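(* Let $q\in C[-b,b]$ be complex valued, let $f$ be a solution of $f''=qf$ on $[-b,b]$ with $f\neq0$ on $[-b,b]$, $f(0)=1$, and $h:=f'(0)$. Let $q\in C^N[-c,c]$, where $[-c,c]\subset[-b,b]$, and let the coefficients $a_n$ ($0\le n\le N+1$), $b_n$ ($1\le n\le N+1$) be defined by the generalized Taylor expansions, as $x\to0$, $$\frac h2+\frac14\int_0^xq(s)\,ds=\sum_{n=0}^{N+1}a_n\frac{\mathbf{c}_n(x)}{n!}+o(x^{N+1})\qquad\text{and}\qquad\frac14\int_0^xq(s)\,ds=\sum_{n=1}^{N+1}b_n\frac{\mathbf{s}_n(x)}{n!}+o(x^{N+1}).$$ Then $$a_{2n}=b_{2n},\qquad n=1,\ldots,\left[\frac{N+1}2\right].$$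
   Context: $[\cdot]$ in the last formula is the integer part; $c>0$. Functions $\varphi_k$ on $[-b,b]$: $X^{(0)}\equiv\widetilde X^{(0)}\equiv1$, $X^{(n)}(x)=n\int_0^x X^{(n-1)}(s)\left(f^2(s)\right)^{(-1)^n}ds$, $\widetilde X^{(n)}(x)=n\int_0^x \widetilde X^{(n-1)}(s)\left(f^2(s)\right)^{(-1)^{n-1}}ds$ for $n\ge1$; $\varphi_k=fX^{(k)}$ for $k$ odd, $\varphi_k=f\widetilde X^{(k)}$ for $k$ even. Then $\mathbf{c}_0=f$, $\mathbf{s}_0\equiv0$, and for $m\ge1$, $\mathbf{c}_m(x)=\sum_{\text{even }k=0}^m\binom mk x^k\varphi_{m-k}(x)$, $\mathbf{s}_m(x)=\sum_{\text{odd }k=1}^m\binom mk x^k\varphi_{m-k}(x)$. For $q\in C^N[-c,c]$ such expansions exist (generalized Taylor theorem) and their coefficients are uniquely determined. *)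

theory Defs
  imports "HOL-Analysis.Analysis" "HOL-Library.Landau_Symbols"
begin

text \<open>The class \<open>C\<^sup>n(S)\<close> for functions of a real variable. All derivatives are taken relative to
  \<open>S\<close>, so they are one-sided at the end points of a compact interval.\<close>

definition Cn_on :: "nat \<Rightarrow> (real \<Rightarrow> 'a::real_normed_vector) \<Rightarrow> real set \<Rightarrow> bool" where
  "Cn_on n g S \<longleftrightarrow> (\<exists>D. D 0 = g
     \<and> (\<forall>k<n. \<forall>x\<in>S. (D k has_vector_derivative D (Suc k) x) (at x within S))
     \<and> (\<forall>k\<le>n. continuous_on S (D k)))"

text \<open>The integral \<open>LBINT s=0..x\<close> is oriented: it is minus the integral over \<open>[x,0]\<close> if \<open>x < 0\<close>.\<close>

primrec formal_X :: "(real \<Rightarrow> complex) \<Rightarrow> nat \<Rightarrow> real \<Rightarrow> complex" where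
  "formal_X f 0 = (\<lambda>x. 1)"
| "formal_X f (Suc n) = (\<lambda>x. of_nat (Suc n) *
     (LBINT s=0..x. formal_X f n s * ((f s)\<^sup>2) powi ((-1) ^ Suc n)))"

primrec formal_X_tilde :: "(real \<Rightarrow> complex) \<Rightarrow> nat \<Rightarrow> real \<Rightarrow> complex" where
  "formal_X_tilde f 0 = (\<lambda>x. 1)"
| "formal_X_tilde f (Suc n) = (\<lambda>x. of_nat (Suc n) *
     (LBINT s=0..x. formal_X_tilde f n s * ((f s)\<^sup>2) powi ((-1) ^ n)))"

definition phi :: "(real \<Rightarrow> complex) \<Rightarrow> nat \<Rightarrow> real \<Rightarrow> complex" where
  "phi f k x = (if odd k then f x * formal_X f k x else f x * formal_X_tilde f k x)"

definition wave_c :: "(real \<Rightarrow> complex) \<Rightarrow> nat \<Rightarrow> real \<Rightarrow> complex" where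
  "wave_c f m x = (\<Sum>k | k \<le> m \<and> even k. of_nat (m choose k) * of_real x ^ k * phi f (m - k) x)"

definition wave_s :: "(real \<Rightarrow> complex) \<Rightarrow> nat \<Rightarrow> real \<Rightarrow> complex" where
  "wave_s f m x = (\<Sum>k | k \<le> m \<and> odd k. of_nat (m choose k) * of_real x ^ k * phi f (m - k) x)"

text \<open>The case \<open>m = 0\<close>, usually given separately, is covered by the same formulas.\<close>

lemma wave_c_0: "wave_c f 0 = f"
proof -
  have "{k::nat. k = 0 \<and> even k} = {0}" by auto
  then show ?thesis by (simp add: wave_c_def phi_def fun_eq_iff)
qed

lemma wave_s_0: "wave_s f 0 = (\<lambda>x. 0)"
  unfolding wave_s_def fun_eq_iff by (auto intro!: sum.neutral)

end

theory Submission
  imports Defs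
begin

text \<open>
  Write \<open>P\<^sub>j = \<phi>\<^sub>j / j!\<close>, let \<open>M = N + 1\<close> and combine the two
  expansions into one function of two variables,
  \<open>K(x,t) = \<Sum>\<^sub>j\<^sub>+\<^sub>k\<^sub>\<le>\<^sub>M e\<^sub>j\<^sub>k P\<^sub>j(x) t\<^sup>k / k!\<close>, where \<open>e\<^sub>j\<^sub>k\<close> is \<open>a\<^sub>j\<^sub>+\<^sub>k\<close> for even \<open>k\<close> and
  \<open>b\<^sub>j\<^sub>+\<^sub>k\<close> for odd \<open>k\<close>. Because \<open>P\<^sub>j'' = q P\<^sub>j + P\<^sub>j\<^sub>-\<^sub>2\<close> and \<open>e\<close> is invariant under
  \<open>(j+2, k) \<mapsto> (j, k+2)\<close>, \<open>K\<close> solves the wave equation \<open>K\<^sub>x\<^sub>x - q K = K\<^sub>t\<^sub>t\<close>. The sum and the difference of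
  the two expansions say that, up to \<open>o(x\<^sup>M)\<close>, \<open>K(x,x) = h/2 + (1/2) \<integral>\<^sub>0\<^sup>x q\<close> and \<open>K(-x,x) = h/2\<close>.
  These are the characteristic data of the kernel of a transmutation operator, and the operator
  \<open>u \<mapsto> u - \<integral>\<^bsub>-x\<^esub>\<^bsup>x\<^esup> K(s,x) u(s) ds\<close>, with the two arguments of the kernel exchanged, is its
  approximate inverse: it sends \<open>P\<^sub>m\<close> to \<open>x\<^sup>m / m! + o(x\<^sup>M)\<close> (lemma \<open>pullback_asymp\<close>).

  Apply this operator to \<open>K(\<cdot>, t)\<close> and put \<open>t = -x\<close>. With
  \<open>k(x,t) = \<Sum> e\<^sub>j\<^sub>k (x\<^sup>j / j!) (t\<^sup>k / k!)\<close>, this gives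
  \<open>k(x,-x) = K(x,-x) - \<integral>\<^bsub>-x\<^esub>\<^bsup>x\<^esup> K(s,x) K(s,-x) ds + o(x\<^sup>M)\<close>. The integral is an odd function of
  \<open>x\<close>, since the integrand is symmetric in \<open>x\<close> and \<open>-x\<close> while the path of integration is reversed.
  Hence it cancels from \<open>k(x,-x) + k(-x,x)\<close>, which therefore equals \<open>h + o(x\<^sup>M)\<close> (lemma
  \<open>free_kernel_symmetrised\<close>). But \<open>k(x,-x)\<close> is a polynomial whose coefficient at \<open>x\<^sup>n\<close>, for even
  \<open>n > 0\<close>, is \<open>2\<^sup>n\<^sup>-\<^sup>1 (a\<^sub>n - b\<^sub>n) / n!\<close>, so all these coefficients with \<open>n \<le> M\<close> vanish.
\<close>

section \<open>Functions of order \<open>o(x\<^sup>n)\<close> at the origin\<close>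

lemma flat_at_0_imp_zero:
  fixes F :: "real \<Rightarrow> complex"
  assumes "F \<in> o[at 0](\<lambda>x. of_real x ^ n)" "isCont F 0"
  shows "F 0 = 0"
proof -
  have "(\<lambda>x::real. complex_of_real x ^ n) \<in> O[at 0](\<lambda>_. 1)"
    by (rule bigoI_tendsto[where c = "of_real 0 ^ n"]) (auto intro!: tendsto_eq_intros)
  then have "F \<in> o[at 0](\<lambda>_. 1)"
    using assms(1) landau_o.small_big_trans by blast
  then have "F \<midarrow>0\<rightarrow> 0"
    using smalloD_tendsto by fastforce
  then show ?thesis
    using assms(2) LIM_unique by (fastforce simp: isCont_def)
qed

lemma flat_mult_continuous:
  fixes F G :: "real \<Rightarrow> complex"
  assumes "F \<in> o[at 0](\<lambda>x. of_real x ^ n)" "isCont G 0"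
  shows "(\<lambda>x. F x * G x) \<in> o[at 0](\<lambda>x. of_real x ^ n)"
proof -
  have "G \<in> O[at 0](\<lambda>_. 1)"
    by (rule bigoI_tendsto[where c = "G 0"]) (use assms(2) in \<open>auto simp: isCont_def\<close>)
  then show ?thesis
    using landau_o.small_big_mult[OF assms(1)] by force
qed

lemma flat_reflect:
  fixes F :: "real \<Rightarrow> complex"
  assumes "F \<in> o[at 0](\<lambda>x. of_real x ^ n)"
  shows "(\<lambda>x. F (- x)) \<in> o[at 0](\<lambda>x. of_real x ^ n)"
proof -
  have "filterlim uminus (at (0::real)) (at 0)"
    using filtermap_at_minus[of "0::real"] by (simp add: filterlim_def)
  then have "(\<lambda>x. F (- x)) \<in> o[at 0](\<lambda>x. of_real (- x) ^ n)"
    by (rule landau_o.small.compose[OF assms])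
  also have "(\<lambda>x. complex_of_real (- x) ^ n) = (\<lambda>x. (-1) ^ n * complex_of_real x ^ n)"
    by (simp add: fun_eq_iff power_minus[of "of_real _"])
  finally show ?thesis
    by simp
qed

text \<open>The order gained by integration is given away, so that all error terms below have the same order.
  The value of \<open>G\<close> at \<open>0\<close> is not controlled by the hypothesis, hence the mean value inequality is
  used on each side of \<open>0\<close> separately.\<close>

lemma flat_antiderivative:
  fixes F G :: "real \<Rightarrow> complex"
  assumes "0 < r"
    and deriv: "\<And>x. \<bar>x\<bar> < r \<Longrightarrow> (F has_vector_derivative G x) (at x)"
    and "F 0 = 0" and flat: "G \<in> o[at 0](\<lambda>x. of_real x ^ n)"
  shows "F \<in> o[at 0](\<lambda>x. of_real x ^ n)"
proof (rule landau_o.smallI)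
  fix \<epsilon> :: real
  assume "\<epsilon> > 0"
  have "\<forall>\<^sub>F x in at 0. cmod (G x) \<le> \<epsilon> * cmod (complex_of_real x ^ n)"
    using landau_o.smallD[OF flat \<open>\<epsilon> > 0\<close>] .
  then obtain d where d: "d > 0"
    and le: "\<And>x. x \<noteq> 0 \<Longrightarrow> \<bar>x\<bar> < d \<Longrightarrow> cmod (G x) \<le> \<epsilon> * \<bar>x\<bar> ^ n"
    by (auto simp: eventually_at norm_power)
  define \<delta> where "\<delta> = min (min d r) 1"
  have \<delta>: "\<delta> > 0" "\<delta> \<le> d" "\<delta> \<le> r" "\<delta> \<le> 1"
    using d \<open>0 < r\<close> by (auto simp: \<delta>_def)
  have "cmod (F x) \<le> \<epsilon> * \<bar>x\<bar> ^ n" if x: "x \<noteq> 0" "\<bar>x\<bar> < \<delta>" for x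
  proof -
    have cont: "continuous_on S F" if "S \<subseteq> {-\<delta><..<\<delta>}" for S
      using that \<delta> by (intro continuous_at_imp_continuous_on ballI
          has_vector_derivative_continuous[OF deriv]) force
    define K where "K = \<epsilon> * \<bar>x\<bar> ^ n"
    have small: "cmod (G s) \<le> K" if "s \<noteq> 0" "\<bar>s\<bar> < \<bar>x\<bar>" for s
    proof -
      have "\<bar>s\<bar> ^ n \<le> \<bar>x\<bar> ^ n"
        using that by (intro power_mono) auto
      then show ?thesis
        unfolding K_def using le[of s] that x \<delta> \<open>\<epsilon> > 0\<close> by (smt (verit) mult_left_mono)
    qed
    have lin: "((\<lambda>s. K * s) has_vector_derivative K) (at s)" for s
      by (auto intro!: derivative_eq_intros simp flip: has_real_derivative_iff_has_vector_derivative)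
    have "cmod (F x) \<le> K * \<bar>x\<bar>"
    proof (cases "x > 0")
      case True
      have "norm (F x - F 0) \<le> K * x - K * 0"
        by (rule differentiable_bound_general[OF True, where f' = G and \<phi>' = "\<lambda>_. K"])
          (use x \<delta> True in \<open>auto intro!: cont continuous_intros deriv lin small\<close>)
      then show ?thesis
        using True \<open>F 0 = 0\<close> by simp
    next
      case False
      then have "x < 0"
        using x by simp
      have "norm (F 0 - F x) \<le> K * 0 - K * x"
        by (rule differentiable_bound_general[OF \<open>x < 0\<close>, where f' = G and \<phi>' = "\<lambda>_. K"])
          (use x \<delta> \<open>x < 0\<close> in \<open>auto intro!: cont continuous_intros deriv lin small\<close>)
      then show ?thesis
        using \<open>x < 0\<close> \<open>F 0 = 0\<close> by simp
    qed
    also have "\<dots> \<le> K * 1"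
      using x \<delta> \<open>\<epsilon> > 0\<close> by (intro mult_left_mono) (auto simp: K_def)
    finally show ?thesis
      by (simp add: K_def)
  qed
  then show "\<forall>\<^sub>F x in at 0. cmod (F x) \<le> \<epsilon> * cmod (complex_of_real x ^ n)"
    using \<delta>(1) by (auto simp: eventually_at norm_power)
qed

lemma flat_polynomial_coeffs_zero:
  fixes a :: "nat \<Rightarrow> complex"
  assumes "(\<lambda>x::real. \<Sum>k\<le>n. a k * of_real x ^ k) \<in> o[at 0](\<lambda>x. of_real x ^ n)" and "k \<le> n"
  shows "a k = 0"
  using assms
proof (induction n arbitrary: a k)
  case 0
  then show ?case
    using flat_at_0_imp_zero[OF 0(1)] by simp
next
  case (Suc n)
  have a0: "a 0 = 0"
    using flat_at_0_imp_zero[OF Suc.prems(1)] by (simp add: sum.atMost_Suc_shift)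
  have "(\<lambda>x::real. of_real x * (\<Sum>k\<le>n. a (Suc k) * of_real x ^ k))
      \<in> o[at 0](\<lambda>x. of_real x * complex_of_real x ^ n)"
    using Suc.prems(1) a0 by (simp add: sum.atMost_Suc_shift sum_distrib_left mult_ac del: sum.atMost_Suc)
  then have "(\<lambda>x::real. \<Sum>k\<le>n. a (Suc k) * of_real x ^ k) \<in> o[at 0](\<lambda>x. of_real x ^ n)"
    by (subst (asm) landau_o.small.mult_cancel_left) (auto simp: eventually_at intro!: exI[of _ 1])
  from Suc.IH[OF this] show ?case
    using a0 Suc.prems(2) by (cases k) auto
qed

section \<open>Functions determined by their derivative\<close>

lemma has_vector_derivative_LBINT_0:
  fixes g :: "real \<Rightarrow> complex"
  assumes "continuous_on {-r<..<r} g" and "\<bar>x\<bar> < r"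
  shows "((\<lambda>x. LBINT s=0..x. g s) has_vector_derivative g x) (at x)"
proof -
  define d where "d = (\<bar>x\<bar> + r) / 2"
  have d: "\<bar>x\<bar> < d" "d < r"
    using assms(2) by (auto simp: d_def)
  have "((\<lambda>x. LBINT s=ereal 0..x. g s) has_vector_derivative g x) (at x within {-d..d})"
    using d by (intro interval_integral_FTC2 continuous_on_subset[OF assms(1)]) auto
  moreover have "at x within {-d..d} = at x"
    using d by (intro at_within_interior) auto
  ultimately show ?thesis
    by (simp add: zero_ereal_def)
qed

lemma equal_derivatives_imp_equal:
  fixes F G :: "real \<Rightarrow> complex"
  assumes F: "\<And>x. \<bar>x\<bar> < r \<Longrightarrow> (F has_vector_derivative D x) (at x)"
    and G: "\<And>x. \<bar>x\<bar> < r \<Longrightarrow> (G has_vector_derivative D x) (at x)"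
    and "F 0 = G 0" and "\<bar>x\<bar> < r"
  shows "F x = G x"
proof -
  have "((\<lambda>x. F x - G x) has_vector_derivative 0) (at y within {-r<..<r})"
    if "y \<in> {-r<..<r}" for y
    using has_vector_derivative_diff[OF F G, of y] that
    by (auto intro: has_vector_derivative_at_within)
  then obtain C where "\<And>y. y \<in> {-r<..<r} \<Longrightarrow> F y - G y = C"
    by (rule has_vector_derivative_zero_constant[rotated]) auto
  moreover have "0 \<in> {-r<..<r}" "x \<in> {-r<..<r}"
    using assms(4) by auto
  ultimately have "F 0 - G 0 = C" "F x - G x = C"
    by blast+
  then show ?thesis
    using assms(3) by simp
qed

lemma has_vector_derivative_reflect:
  assumes "(F has_vector_derivative D) (at (- x))"
  shows "((\<lambda>x. F (- x)) has_vector_derivative - D) (at x)"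
proof -
  have "((F \<circ> uminus) has_vector_derivative (- 1) *\<^sub>R D) (at x)"
    using assms by (intro vector_diff_chain_at) (auto intro!: derivative_eq_intros)
  then show ?thesis
    by (simp add: o_def)
qed

section \<open>Divided powers and double sums\<close>

text \<open>Divided powers carry the factorials, so that differentiation becomes a pure index shift.\<close>

definition divpow :: "nat \<Rightarrow> real \<Rightarrow> complex" where
  "divpow k t = of_real t ^ k / fact k"

text \<open>The truncation to \<open>0\<close> for \<open>k < i\<close> matches \<open>F\<^sub>k = 0\<close> for negative \<open>k\<close>, so recurrences such as
  \<open>P\<^sub>k'' = q P\<^sub>k + P\<^sub>k\<^sub>-\<^sub>2\<close> need no special cases.\<close>

definition lag :: "nat \<Rightarrow> (nat \<Rightarrow> 'a \<Rightarrow> complex) \<Rightarrow> nat \<Rightarrow> 'a \<Rightarrow> complex" where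
  "lag i F k x = (if k < i then 0 else F (k - i) x)"

lemma divpow_0: "divpow k 0 = (if k = 0 then 1 else 0)"
  by (simp add: divpow_def)

lemma divpow_uminus: "divpow k (- t) = (- 1) ^ k * divpow k t"
  by (simp add: divpow_def power_minus[of "of_real _"])

lemma has_vector_derivative_divpow [derivative_intros]:
  "(divpow k has_vector_derivative lag 1 divpow k t) (at t)"
proof -
  have "((\<lambda>z. z ^ k / fact k) has_field_derivative lag 1 divpow k t) (at (complex_of_real t))"
  proof (rule DERIV_cong[OF DERIV_cdivide[OF DERIV_power[OF DERIV_ident]]])
    show "of_nat k * (1 * complex_of_real t ^ (k - Suc 0)) / fact k = lag 1 divpow k t"
      by (cases k) (simp_all add: lag_def divpow_def field_simps del: of_nat_Suc)
  qed
  then show ?thesis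
    unfolding divpow_def[abs_def] by (rule has_vector_derivative_real_field)
qed

lemma has_vector_derivative_lag_divpow [derivative_intros]:
  "(lag 1 divpow k has_vector_derivative lag 2 divpow k t) (at t)"
proof (cases k)
  case 0
  then show ?thesis
    by (simp add: lag_def[abs_def])
next
  case (Suc i)
  then show ?thesis
    using has_vector_derivative_divpow[of i t] by (cases i) (auto simp: lag_def[abs_def])
qed

lemma finite_pairs_le: "finite {(j, k). j + k \<le> (n::nat)}"
  by (rule finite_subset[of _ "{..n} \<times> {..n}"]) auto

lemma sum_pairs_le_by_total:
  "(\<Sum>(j, k) | j + k \<le> n. g j k) = (\<Sum>m\<le>n. \<Sum>k\<le>m. g (m - k) k)" for n :: nat
proof -
  have "(\<Sum>i\<le>m. g i (m - i)) = (\<Sum>k\<le>m. g (m - k) k)" for m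
    by (rule sum.reindex_bij_witness[of _ "\<lambda>i. m - i" "\<lambda>i. m - i"]) auto
  then show ?thesis
    by (simp add: sum.triangle_reindex_eq)
qed

section \<open>Formal powers of a Schroedinger operator\<close>

text \<open>The divided formal powers \<open>P\<^sub>j = \<phi>\<^sub>j / j!\<close>, known only through the differential recurrence
  \<open>P\<^sub>j'' - q P\<^sub>j = P\<^sub>j\<^sub>-\<^sub>2\<close> and their Cauchy data at the origin. They are the counterparts of the
  divided powers \<open>x\<^sup>j / j!\<close>, which are the case \<open>q = 0\<close>, \<open>h = 0\<close>.\<close>

locale formal_powers =
  fixes r :: real and q :: "real \<Rightarrow> complex" and h :: complex
    and P P' :: "nat \<Rightarrow> real \<Rightarrow> complex"
  assumes r_pos: "0 < r"
    and P_deriv: "\<And>j x. \<bar>x\<bar> < r \<Longrightarrow> (P j has_vector_derivative P' j x) (at x)"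
    and P'_deriv: "\<And>j x. \<bar>x\<bar> < r \<Longrightarrow>
      (P' j has_vector_derivative q x * P j x + lag 2 P j x) (at x)"
    and P_0: "\<And>j. P j 0 = (if j = 0 then 1 else 0)"
    and P'_0: "\<And>j. P' j 0 = (if j = 0 then h else if j = 1 then 1 else 0)"
begin

definition prim :: "nat \<Rightarrow> nat \<Rightarrow> real \<Rightarrow> complex" where
  "prim j m x = (LBINT s=0..x. P j s * P m s)"

text \<open>This is the integral of \<open>P\<^sub>j P\<^sub>m\<close> over \<open>[-x, x]\<close>.\<close>

definition sym_prim :: "nat \<Rightarrow> nat \<Rightarrow> real \<Rightarrow> complex" where
  "sym_prim j m x = prim j m x - prim j m (- x)"

lemma prim_0: "prim j m 0 = 0"
  by (simp add: prim_def flip: zero_ereal_def)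

lemma sym_prim_commute: "sym_prim j m = sym_prim m j"
  by (simp add: sym_prim_def prim_def fun_eq_iff mult.commute)

lemma sym_prim_uminus: "sym_prim j m (- x) = - sym_prim j m x"
  by (simp add: sym_prim_def)

lemma sym_prim_0: "sym_prim j m 0 = 0"
  by (simp add: sym_prim_def)

lemma isCont_P: "\<bar>x\<bar> < r \<Longrightarrow> isCont (P j) x"
  using P_deriv has_vector_derivative_continuous by blast

lemma prim_deriv: "\<bar>x\<bar> < r \<Longrightarrow> (prim j m has_vector_derivative P j x * P m x) (at x)"
  unfolding prim_def[abs_def]
  by (rule has_vector_derivative_LBINT_0)
    (auto intro!: continuous_at_imp_continuous_on isCont_P continuous_intros)

lemma sym_prim_deriv:
  assumes "\<bar>x\<bar> < r"
  shows "(sym_prim j m has_vector_derivative P j x * P m x + P j (- x) * P m (- x)) (at x)"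
proof -
  have "((\<lambda>x. prim j m (- x)) has_vector_derivative - (P j (- x) * P m (- x))) (at x)"
    using assms by (intro has_vector_derivative_reflect prim_deriv) auto
  from has_vector_derivative_diff[OF prim_deriv[OF assms, of j m] this] show ?thesis
    unfolding sym_prim_def[abs_def] by simp
qed

text \<open>Green's identity: the terms with \<open>q\<close> cancel in the derivative of the Wronskian
  \<open>P\<^sub>j' P\<^sub>m - P\<^sub>j P\<^sub>m'\<close>, which leaves \<open>P\<^sub>j\<^sub>-\<^sub>2 P\<^sub>m - P\<^sub>j P\<^sub>m\<^sub>-\<^sub>2\<close>.\<close>

lemma lag_prim_green:
  assumes "\<bar>x\<bar> < r"
  shows "lag 2 (\<lambda>i. prim i m) j x + (P' j 0 * P m 0 - P j 0 * P' m 0)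
    = lag 2 (prim j) m x + (P' j x * P m x - P j x * P' m x)"
proof (rule equal_derivatives_imp_equal[OF _ _ _ assms])
  fix x :: real
  assume x: "\<bar>x\<bar> < r"
  have A1: "(lag 2 (\<lambda>i. prim i m) j has_vector_derivative lag 2 P j x * P m x) (at x)"
    using prim_deriv[OF x] by (auto simp: lag_def[abs_def])
  have A2: "(lag 2 (prim j) m has_vector_derivative P j x * lag 2 P m x) (at x)"
    using prim_deriv[OF x] by (auto simp: lag_def[abs_def])
  show "((\<lambda>x. lag 2 (\<lambda>i. prim i m) j x + (P' j 0 * P m 0 - P j 0 * P' m 0))
      has_vector_derivative lag 2 P j x * P m x) (at x)"
    using has_vector_derivative_add[OF A1 has_vector_derivative_const] by simp
  show "((\<lambda>x. lag 2 (prim j) m x + (P' j x * P m x - P j x * P' m x))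
      has_vector_derivative lag 2 P j x * P m x) (at x)"
    by (rule has_vector_derivative_eq_rhs,
        rule has_vector_derivative_add[OF A2 has_vector_derivative_diff[OF
          has_vector_derivative_mult[OF P'_deriv P_deriv]
          has_vector_derivative_mult[OF P_deriv P'_deriv]]])
      (use x in \<open>auto simp: algebra_simps\<close>)
qed (auto simp: lag_def prim_0)

lemma lag_sym_prim_green:
  assumes "\<bar>x\<bar> < r"
  shows "lag 2 (\<lambda>i. sym_prim i m) j x = lag 2 (sym_prim j) m x
    + (P' j x * P m x - P j x * P' m x) - (P' j (- x) * P m (- x) - P j (- x) * P' m (- x))"
proof -
  have "lag 2 (\<lambda>i. sym_prim i m) j x = lag 2 (\<lambda>i. prim i m) j x - lag 2 (\<lambda>i. prim i m) j (- x)"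
    "lag 2 (sym_prim j) m x = lag 2 (prim j) m x - lag 2 (prim j) m (- x)"
    by (auto simp: lag_def sym_prim_def)
  moreover have "\<bar>- x\<bar> < r"
    using assms by simp
  ultimately show ?thesis
    using lag_prim_green[OF assms, of m j] lag_prim_green[of "- x" m j] by algebra
qed

end

section \<open>An approximate transmutation kernel\<close>

text \<open>The coefficient of \<open>P\<^sub>j(x) t\<^sup>k / k!\<close>: on \<open>t = x\<close> the even powers of \<open>t\<close> make up the functions
  \<open>c\<^sub>n\<close> with \<open>n = j + k\<close>, the odd powers the functions \<open>s\<^sub>n\<close>.\<close>

definition interlace :: "(nat \<Rightarrow> complex) \<Rightarrow> (nat \<Rightarrow> complex) \<Rightarrow> nat \<Rightarrow> nat \<Rightarrow> complex" where
  "interlace \<alpha> \<beta> j k = (if even k then \<alpha> (j + k) else \<beta> (j + k))"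

text \<open>A finite combination of wave polynomials whose values on the two characteristics \<open>t = x\<close>
  and \<open>t = -x\<close> agree to order \<open>o(x\<^sup>M)\<close> with those of an exact transmutation kernel.\<close>

locale approximate_kernel = formal_powers +
  fixes M :: nat and \<alpha> \<beta> :: "nat \<Rightarrow> complex" and Q :: "real \<Rightarrow> complex"
  assumes Q_deriv: "\<And>x. \<bar>x\<bar> < r \<Longrightarrow> (Q has_vector_derivative q x) (at x)"
    and Q_0: "Q 0 = 0"
    and diagonal: "(\<lambda>x. 2 * (\<Sum>(j, k) | j + k \<le> M. interlace \<alpha> \<beta> j k * P j x * divpow k x) - h - Q x)
      \<in> o[at 0](\<lambda>x. of_real x ^ M)"
    and antidiagonal: "(\<lambda>x. 2 * (\<Sum>(j, k) | j + k \<le> M. interlace \<alpha> \<beta> j k * P j (- x) * divpow k x) - h)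
      \<in> o[at 0](\<lambda>x. of_real x ^ M)"
begin

abbreviation e :: "nat \<Rightarrow> nat \<Rightarrow> complex" where
  "e \<equiv> interlace \<alpha> \<beta>"

text \<open>This invariance expresses that the kernel solves the wave equation.\<close>

lemma e_shift: "e (j + 2) k = e j (k + 2)"
  by (simp add: interlace_def)

definition kernel :: "real \<Rightarrow> real \<Rightarrow> complex" where
  "kernel x t = (\<Sum>(j, k) | j + k \<le> M. e j k * P j x * divpow k t)"

definition kernel_x :: "real \<Rightarrow> real \<Rightarrow> complex" where
  "kernel_x x t = (\<Sum>(j, k) | j + k \<le> M. e j k * P' j x * divpow k t)"

definition kernel_t :: "real \<Rightarrow> real \<Rightarrow> complex" where
  "kernel_t x t = (\<Sum>(j, k) | j + k \<le> M. e j k * P j x * lag 1 divpow k t)"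

text \<open>The image of \<open>P\<^sub>m\<close> under \<open>u \<mapsto> u - \<integral>\<^bsub>-x\<^esub>\<^bsup>x\<^esup> K(s,x) u(s) ds\<close>. The kernel has finite rank, so this
  integral is a finite sum and can be differentiated term by term.\<close>

definition pullback :: "nat \<Rightarrow> real \<Rightarrow> complex" where
  "pullback m x = P m x - (\<Sum>(j, k) | j + k \<le> M. e j k * divpow k x * sym_prim j m x)"

text \<open>For an exact kernel this is the derivative of \<open>pullback m\<close>. In general the boundary values
  \<open>K(x,x)\<close> and \<open>K(-x,x)\<close> enter that derivative with the opposite sign. Adding twice their deviation
  from the exact data, multiplied by \<open>P\<^sub>m(x)\<close> and \<open>P\<^sub>m(-x)\<close>, costs only \<open>o(x\<^sup>M)\<close>. It flips these signs,
  and as a result no deviation is differentiated in the next step, where the derivative of an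
  \<open>o(x\<^sup>M)\<close> term could not be estimated.\<close>

definition pullback_diff :: "nat \<Rightarrow> real \<Rightarrow> complex" where
  "pullback_diff m x = P' m x + kernel x x * P m x + kernel (- x) x * P m (- x)
     - (h + Q x) * P m x - h * P m (- x)
     - (\<Sum>(j, k) | j + k \<le> M. e j k * lag 1 divpow k x * sym_prim j m x)"

lemma kernel_diagonal_flat: "(\<lambda>x. 2 * kernel x x - h - Q x) \<in> o[at 0](\<lambda>x. of_real x ^ M)"
  using diagonal by (simp add: kernel_def)

lemma kernel_antidiagonal_flat: "(\<lambda>x. 2 * kernel (- x) x - h) \<in> o[at 0](\<lambda>x. of_real x ^ M)"
  using antidiagonal by (simp add: kernel_def)

lemma P_deriv_reflect:
  "\<bar>x\<bar> < r \<Longrightarrow> ((\<lambda>x. P j (- x)) has_vector_derivative - P' j (- x)) (at x)"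
  by (intro has_vector_derivative_reflect P_deriv) auto

lemma kernel_diagonal_deriv:
  assumes "\<bar>x\<bar> < r"
  shows "((\<lambda>x. kernel x x) has_vector_derivative kernel_x x x + kernel_t x x) (at x)"
  unfolding kernel_def kernel_x_def kernel_t_def sum.distrib[symmetric]
  by (rule has_vector_derivative_sum)
    (auto intro!: derivative_eq_intros P_deriv assms simp: algebra_simps)

lemma kernel_antidiagonal_deriv:
  assumes "\<bar>x\<bar> < r"
  shows "((\<lambda>x. kernel (- x) x) has_vector_derivative kernel_t (- x) x - kernel_x (- x) x) (at x)"
  unfolding kernel_def kernel_x_def kernel_t_def sum_subtractf[symmetric]
  by (rule has_vector_derivative_sum)
    (auto intro!: derivative_eq_intros P_deriv_reflect assms simp: algebra_simps)

text \<open>The characteristic data are attained exactly at the origin, because an error of order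
  \<open>o(x\<^sup>M)\<close> that is continuous vanishes there.\<close>

lemma kernel_0: "2 * kernel 0 0 = h"
proof -
  have "isCont (\<lambda>x. kernel (- x) x) 0"
    using kernel_antidiagonal_deriv[of 0] r_pos by (intro has_vector_derivative_continuous) auto
  then have "isCont (\<lambda>x. 2 * kernel (- x) x - h) 0"
    by (intro continuous_intros)
  from flat_at_0_imp_zero[OF kernel_antidiagonal_flat this] show ?thesis
    by simp
qed

lemma pullback_deriv:
  assumes x: "\<bar>x\<bar> < r"
  shows "(pullback m has_vector_derivative
    pullback_diff m x - (2 * kernel x x - h - Q x) * P m x - (2 * kernel (- x) x - h) * P m (- x)) (at x)"
proof -
  let ?S = "{(j, k). j + k \<le> M}"
  have "((\<lambda>x. \<Sum>(j, k)\<in>?S. e j k * divpow k x * sym_prim j m x) has_vector_derivative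
    (\<Sum>(j, k)\<in>?S. e j k * lag 1 divpow k x * sym_prim j m x
       + e j k * P j x * divpow k x * P m x + e j k * P j (- x) * divpow k x * P m (- x))) (at x)"
    by (rule has_vector_derivative_sum)
      (auto intro!: derivative_eq_intros sym_prim_deriv[OF x] simp: algebra_simps simp del: One_nat_def)
  also have "(\<Sum>(j, k)\<in>?S. e j k * lag 1 divpow k x * sym_prim j m x
       + e j k * P j x * divpow k x * P m x + e j k * P j (- x) * divpow k x * P m (- x))
    = (\<Sum>(j, k)\<in>?S. e j k * lag 1 divpow k x * sym_prim j m x) + kernel x x * P m x + kernel (- x) x * P m (- x)"
    by (simp add: case_prod_unfold sum.distrib kernel_def sum_distrib_right)
  finally show ?thesis
    unfolding pullback_def[abs_def]
    by (rule has_vector_derivative_eq_rhs[OF has_vector_derivative_diff[OF P_deriv[OF x]]])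
      (simp add: pullback_diff_def algebra_simps)
qed

text \<open>The wave equation in terms of coefficients: two \<open>t\<close>-derivatives are traded for a
  shift of the formal powers.\<close>

lemma sum_lag_swap:
  "(\<Sum>(j, k) | j + k \<le> M. e j k * lag 2 divpow k x * F j)
     = (\<Sum>(j, k) | j + k \<le> M. e j k * divpow k x * (if j < 2 then 0 else F (j - 2)))"
proof -
  have "(\<Sum>(j, k) | j + k \<le> M. e j k * lag 2 divpow k x * F j)
    = (\<Sum>(j, k) | j + k \<le> M \<and> 2 \<le> k. e j k * divpow (k - 2) x * F j)"
    by (rule sum.mono_neutral_cong_right[OF finite_pairs_le]) (auto simp: lag_def split: if_splits)
  also have "\<dots> = (\<Sum>(j, k) | j + k \<le> M \<and> 2 \<le> j. e j k * divpow k x * F (j - 2))"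
    by (rule sum.reindex_bij_witness[of _ "\<lambda>(j, k). (j - 2, k + 2)" "\<lambda>(j, k). (j + 2, k - 2)"])
      (auto simp del: One_nat_def add_2_eq_Suc' simp: e_shift)
  also have "\<dots> = (\<Sum>(j, k) | j + k \<le> M. e j k * divpow k x * (if j < 2 then 0 else F (j - 2)))"
    by (rule sum.mono_neutral_cong_left[OF finite_pairs_le]) (auto simp: lag_def split: if_splits)
  finally show ?thesis .
qed

lemma lag_pullback: "lag 2 pullback m x
  = lag 2 P m x - (\<Sum>(j, k) | j + k \<le> M. e j k * divpow k x * lag 2 (sym_prim j) m x)"
  by (simp add: lag_def pullback_def)

text \<open>Two derivatives of the kernel in \<open>t\<close> are moved by the wave equation to the first argument and
  from there by Green's identity to \<open>P\<^sub>m\<close>. All boundary terms combine with the explicit terms of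
  \<open>pullback_diff\<close> and leave the deviations from the exact data, multiplied by \<open>P\<^sub>m'\<close>
  at \<open>x\<close> and \<open>-x\<close>.\<close>

lemma pullback_diff_deriv:
  assumes x: "\<bar>x\<bar> < r"
  shows "(pullback_diff m has_vector_derivative
    lag 2 pullback m x + (2 * kernel x x - h - Q x) * P' m x - (2 * kernel (- x) x - h) * P' m (- x)) (at x)"
proof -
  let ?S = "{(j, k). j + k \<le> M}"
  define R where "R = (\<Sum>(j, k)\<in>?S. e j k * divpow k x * lag 2 (sym_prim j) m x)"
  have "((\<lambda>x. \<Sum>(j, k)\<in>?S. e j k * lag 1 divpow k x * sym_prim j m x) has_vector_derivative
    (\<Sum>(j, k)\<in>?S. e j k * lag 2 divpow k x * sym_prim j m x
       + e j k * P j x * lag 1 divpow k x * P m x + e j k * P j (- x) * lag 1 divpow k x * P m (- x))) (at x)"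
    by (rule has_vector_derivative_sum)
      (auto intro!: derivative_eq_intros sym_prim_deriv[OF x] simp: algebra_simps simp del: One_nat_def)
  also have "(\<Sum>(j, k)\<in>?S. e j k * lag 2 divpow k x * sym_prim j m x
       + e j k * P j x * lag 1 divpow k x * P m x + e j k * P j (- x) * lag 1 divpow k x * P m (- x))
    = (\<Sum>(j, k)\<in>?S. e j k * lag 2 divpow k x * sym_prim j m x) + kernel_t x x * P m x + kernel_t (- x) x * P m (- x)"
    by (simp add: case_prod_unfold sum.distrib kernel_t_def sum_distrib_right)
  also have "(\<Sum>(j, k)\<in>?S. e j k * lag 2 divpow k x * sym_prim j m x)
    = (\<Sum>(j, k)\<in>?S. e j k * divpow k x * lag 2 (\<lambda>i. sym_prim i m) j x)"
    using sum_lag_swap[of x "\<lambda>j. sym_prim j m x"] by (simp add: lag_def)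
  also have "\<dots> = (\<Sum>(j, k)\<in>?S. e j k * divpow k x * lag 2 (sym_prim j) m x
      + e j k * P' j x * divpow k x * P m x - e j k * P j x * divpow k x * P' m x
      - e j k * P' j (- x) * divpow k x * P m (- x) + e j k * P j (- x) * divpow k x * P' m (- x))"
    by (simp only: lag_sym_prim_green[OF x]) (simp add: algebra_simps)
  also have "\<dots> = R + kernel_x x x * P m x - kernel x x * P' m x - kernel_x (- x) x * P m (- x)
      + kernel (- x) x * P' m (- x)"
    by (simp add: case_prod_unfold sum.distrib sum_subtractf kernel_def kernel_x_def R_def sum_distrib_right)
  finally have D: "((\<lambda>x. \<Sum>(j, k)\<in>?S. e j k * lag 1 divpow k x * sym_prim j m x) has_vector_derivative
    R + kernel_x x x * P m x - kernel x x * P' m x - kernel_x (- x) x * P m (- x) + kernel (- x) x * P' m (- x)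
      + kernel_t x x * P m x + kernel_t (- x) x * P m (- x)) (at x)" .
  have L: "lag 2 pullback m x = lag 2 P m x - R"
    by (simp add: lag_pullback R_def)
  show ?thesis
    unfolding pullback_diff_def[abs_def] L
    by (rule derivative_eq_intros P_deriv P'_deriv P_deriv_reflect kernel_diagonal_deriv
        kernel_antidiagonal_deriv Q_deriv D x refl)+ (simp add: algebra_simps)
qed

lemma pullback_0: "pullback m 0 = divpow m 0"
  by (simp add: pullback_def sym_prim_0 P_0 divpow_0 case_prod_unfold)

lemma pullback_diff_0: "pullback_diff m 0 = lag 1 divpow m 0"
  using kernel_0 by (simp add: pullback_diff_def sym_prim_0 P_0 P'_0 Q_0 lag_def divpow_0 case_prod_unfold algebra_simps)

text \<open>Up to \<open>o(x\<^sup>M)\<close>, the second derivative of the image of \<open>P\<^sub>m\<close> is the image of \<open>P\<^sub>m\<^sub>-\<^sub>2\<close>, and the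
  Cauchy data at the origin are those of \<open>x\<^sup>m / m!\<close>. Integrating twice gives the induction step.\<close>

lemma pullback_asymp: "(\<lambda>x. pullback m x - divpow m x) \<in> o[at 0](\<lambda>x. of_real x ^ M)"
proof (induction m rule: less_induct)
  case (less m)
  have lag_flat: "(\<lambda>x. lag 2 pullback m x - lag 2 divpow m x) \<in> o[at 0](\<lambda>x. of_real x ^ M)"
    using less.IH[of "m - 2"] by (cases "m < 2") (auto simp: lag_def)
  have cont_0: "isCont (P' m) 0" "isCont (\<lambda>x. P' m (- x)) 0" "isCont (P m) 0" "isCont (\<lambda>x. P m (- x)) 0"
  proof -
    show "isCont (P' m) 0"
      using P'_deriv[of 0 m] r_pos by (intro has_vector_derivative_continuous) auto
    then show "isCont (\<lambda>x. P' m (- x)) 0"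
      by (intro isCont_o2[where g = "P' m" and f = uminus]) auto
    show "isCont (P m) 0"
      using isCont_P r_pos by auto
    then show "isCont (\<lambda>x. P m (- x)) 0"
      by (intro isCont_o2[where g = "P m" and f = uminus]) auto
  qed
  have pullback_diff_flat: "(\<lambda>x. pullback_diff m x - lag 1 divpow m x) \<in> o[at 0](\<lambda>x. of_real x ^ M)"
  proof (rule flat_antiderivative[OF r_pos])
    fix x :: real
    assume x: "\<bar>x\<bar> < r"
    show "((\<lambda>x. pullback_diff m x - lag 1 divpow m x) has_vector_derivative
      (lag 2 pullback m x + (2 * kernel x x - h - Q x) * P' m x - (2 * kernel (- x) x - h) * P' m (- x))
      - lag 2 divpow m x) (at x)"
      by (intro has_vector_derivative_diff pullback_diff_deriv x has_vector_derivative_lag_divpow)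
  next
    show "(\<lambda>x. (lag 2 pullback m x + (2 * kernel x x - h - Q x) * P' m x - (2 * kernel (- x) x - h) * P' m (- x))
      - lag 2 divpow m x) \<in> o[at 0](\<lambda>x. of_real x ^ M)"
      using sum_in_smallo(2)[OF sum_in_smallo(1)[OF lag_flat
          flat_mult_continuous[OF kernel_diagonal_flat cont_0(1)]]
        flat_mult_continuous[OF kernel_antidiagonal_flat cont_0(2)]]
      by (simp add: algebra_simps)
  qed (simp add: pullback_diff_0)
  show ?case
  proof (rule flat_antiderivative[OF r_pos])
    fix x :: real
    assume x: "\<bar>x\<bar> < r"
    show "((\<lambda>x. pullback m x - divpow m x) has_vector_derivative
      (pullback_diff m x - (2 * kernel x x - h - Q x) * P m x - (2 * kernel (- x) x - h) * P m (- x))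
      - lag 1 divpow m x) (at x)"
      by (intro has_vector_derivative_diff pullback_deriv x has_vector_derivative_divpow)
  next
    show "(\<lambda>x. (pullback_diff m x - (2 * kernel x x - h - Q x) * P m x - (2 * kernel (- x) x - h) * P m (- x))
      - lag 1 divpow m x) \<in> o[at 0](\<lambda>x. of_real x ^ M)"
      using sum_in_smallo(2)[OF sum_in_smallo(2)[OF pullback_diff_flat
          flat_mult_continuous[OF kernel_diagonal_flat cont_0(3)]]
        flat_mult_continuous[OF kernel_antidiagonal_flat cont_0(4)]]
      by (simp add: algebra_simps)
  qed (simp add: pullback_0)
qed

section \<open>Comparison with the free wave equation\<close>

text \<open>The antidiagonal values \<open>k(x,-x)\<close> of the solution \<open>k\<close> of the free wave equation \<open>k\<^sub>x\<^sub>x = k\<^sub>t\<^sub>t\<close>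
  that arises from \<open>K\<close> when \<open>P\<^sub>j\<close> is replaced by \<open>x\<^sup>j / j!\<close>.\<close>

definition free_kernel :: "real \<Rightarrow> complex" where
  "free_kernel x = (\<Sum>(j, k) | j + k \<le> M. e j k * divpow j x * divpow k (- x))"

text \<open>This is \<open>\<integral>\<^bsub>-x\<^esub>\<^bsup>x\<^esup> K(s,x) K(s,-x) ds\<close>.\<close>

definition kernel_square :: "real \<Rightarrow> complex" where
  "kernel_square x = (\<Sum>(m, l) | m + l \<le> M. \<Sum>(j, k) | j + k \<le> M.
    e m l * e j k * divpow l (- x) * divpow k x * sym_prim j m x)"

text \<open>Replacing \<open>x\<close> by \<open>-x\<close> exchanges the two factors of the integrand and reverses the path of
  integration.\<close>

lemma kernel_square_uminus: "kernel_square (- x) = - kernel_square x"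
proof -
  have "kernel_square (- x) = (\<Sum>(m, l) | m + l \<le> M. \<Sum>(j, k) | j + k \<le> M.
      - (e j k * e m l * divpow k (- x) * divpow l x * sym_prim m j x))"
    unfolding kernel_square_def by (intro sum.cong refl) (auto simp: sym_prim_uminus sym_prim_commute intro!: sum.cong)
  also have "\<dots> = - kernel_square x"
    unfolding kernel_square_def case_prod_unfold sum_negf by (subst sum.swap) simp
  finally show ?thesis .
qed

text \<open>Apply the approximate inverse to the first argument of \<open>K(x,t)\<close>, term by term, and set
  \<open>t = -x\<close>.\<close>

lemma free_kernel_asymp: "(\<lambda>x. kernel x (- x) - kernel_square x - free_kernel x) \<in> o[at 0](\<lambda>x. of_real x ^ M)"
proof -
  have "(\<lambda>x. \<Sum>(m, l) | m + l \<le> M. (pullback m x - divpow m x) * (e m l * divpow l (- x)))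
    \<in> o[at 0](\<lambda>x. of_real x ^ M)"
    unfolding case_prod_unfold
    by (intro big_sum_in_smallo flat_mult_continuous pullback_asymp)
      (auto simp: divpow_def intro!: continuous_intros)
  also have "(\<lambda>x. \<Sum>(m, l) | m + l \<le> M. (pullback m x - divpow m x) * (e m l * divpow l (- x)))
    = (\<lambda>x. kernel x (- x) - kernel_square x - free_kernel x)"
    unfolding kernel_def kernel_square_def free_kernel_def pullback_def fun_eq_iff
    by (simp add: case_prod_unfold sum_subtractf sum.distrib algebra_simps sum_distrib_left)
  finally show ?thesis .
qed

lemma free_kernel_symmetrised: "(\<lambda>x. free_kernel x + free_kernel (- x) - h) \<in> o[at 0](\<lambda>x. of_real x ^ M)"
proof -
  have "(\<lambda>x. 2 * (kernel (- x) x + kernel x (- x) - h)) \<in> o[at 0](\<lambda>x. of_real x ^ M)"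
    using sum_in_smallo(1)[OF kernel_antidiagonal_flat flat_reflect[OF kernel_antidiagonal_flat]]
    by (simp add: algebra_simps)
  then have kernel: "(\<lambda>x. kernel (- x) x + kernel x (- x) - h) \<in> o[at 0](\<lambda>x. of_real x ^ M)"
    by (subst (asm) landau_o.small.cmult_in_iff) auto
  have "(\<lambda>x. kernel x (- x) - kernel_square x - free_kernel x
      + (kernel (- x) x - kernel_square (- x) - free_kernel (- x))) \<in> o[at 0](\<lambda>x. of_real x ^ M)"
    using sum_in_smallo(1)[OF free_kernel_asymp flat_reflect[OF free_kernel_asymp]] by simp
  from sum_in_smallo(2)[OF kernel this] show ?thesis
    by (simp add: kernel_square_uminus algebra_simps)
qed

definition free_coeff :: "nat \<Rightarrow> complex" where
  "free_coeff n = (\<Sum>k\<le>n. e (n - k) k * (- 1) ^ k * of_nat (n choose k)) / fact n"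

lemma free_kernel_eq: "free_kernel x = (\<Sum>n\<le>M. free_coeff n * of_real x ^ n)"
  unfolding free_kernel_def free_coeff_def sum_pairs_le_by_total sum_divide_distrib sum_distrib_right
  by (intro sum.cong refl)
    (auto simp: divpow_def binomial_fact field_simps power_minus[of "of_real _"] simp flip: power_add)

text \<open>Both the even and the odd binomial coefficients of order \<open>n\<close> sum to \<open>2\<^sup>n\<^sup>-\<^sup>1\<close>, and the odd ones
  carry a minus sign here since \<open>t = -x\<close>.\<close>

lemma free_coeff_even:
  assumes "even n" "n > 0"
  shows "2 * fact n * free_coeff n = 2 ^ n * (\<alpha> n - \<beta> n)"
proof -
  have "2 * fact n * free_coeff n = 2 * (\<Sum>k\<le>n. \<alpha> n * (if even k then of_nat (n choose k) else 0)
      - \<beta> n * (if odd k then of_nat (n choose k) else 0))"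
    by (auto simp: free_coeff_def interlace_def intro!: sum.cong)
  also have "\<dots> = \<alpha> n * (2 * (\<Sum>k\<le>n. if even k then of_nat (n choose k) else 0))
      - \<beta> n * (2 * (\<Sum>k\<le>n. if odd k then of_nat (n choose k) else 0))"
    by (simp only: sum_subtractf flip: sum_distrib_left) (simp add: algebra_simps)
  also have "\<dots> = 2 ^ n * (\<alpha> n - \<beta> n)"
    by (simp only: choose_even_sum[OF assms(2)] choose_odd_sum[OF assms(2)]) (simp add: algebra_simps)
  finally show ?thesis .
qed

text \<open>Symmetrising in \<open>x\<close> keeps the even powers only, and a polynomial of degree at most \<open>M\<close> that is
  \<open>o(x\<^sup>M)\<close> is zero.\<close>

theorem even_coeffs_agree:
  assumes "even n" "0 < n" "n \<le> M"
  shows "\<alpha> n = \<beta> n"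
proof -
  define c where "c n = free_coeff n * (1 + (- 1) ^ n) - (if n = 0 then h else 0)" for n
  have "(\<lambda>x. free_kernel x + free_kernel (- x) - h) = (\<lambda>x. \<Sum>n\<le>M. c n * of_real x ^ n)"
  proof
    fix x
    have "(\<Sum>n\<le>M. c n * of_real x ^ n) = (\<Sum>n\<le>M. free_coeff n * of_real x ^ n
        + free_coeff n * of_real (- x) ^ n - (if n = 0 then h else 0))"
      by (intro sum.cong refl) (auto simp: c_def algebra_simps power_minus[of "of_real _"])
    also have "\<dots> = free_kernel x + free_kernel (- x) - h"
      by (simp add: free_kernel_eq sum.distrib sum_subtractf)
    finally show "free_kernel x + free_kernel (- x) - h = (\<Sum>n\<le>M. c n * of_real x ^ n)" ..
  qed
  then have "c n = 0"
    using free_kernel_symmetrised assms(3) by (intro flat_polynomial_coeffs_zero[of c M]) auto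
  then show ?thesis
    using free_coeff_even[OF assms(1,2)] assms by (simp add: c_def)
qed

end

section \<open>The functions \<open>\<phi>\<^sub>k\<close> as formal powers\<close>

text \<open>The quotient \<open>\<phi>\<^sub>k / f\<close>. Together with its companion, which makes the opposite choice between the
  two families of recursive integrals, it satisfies a recursion that does not depend on parity.\<close>

definition phi_ratio :: "(real \<Rightarrow> complex) \<Rightarrow> nat \<Rightarrow> real \<Rightarrow> complex" where
  "phi_ratio f k x = (if odd k then formal_X f k x else formal_X_tilde f k x)"

definition phi_ratio_dual :: "(real \<Rightarrow> complex) \<Rightarrow> nat \<Rightarrow> real \<Rightarrow> complex" where
  "phi_ratio_dual f k x = (if odd k then formal_X_tilde f k x else formal_X f k x)"

lemma phi_eq_phi_ratio: "phi f k x = f x * phi_ratio f k x"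
  by (simp add: phi_def phi_ratio_def)

lemma phi_ratio_Suc: "phi_ratio f (Suc k) x
  = of_nat (Suc k) * (LBINT s=0..x. phi_ratio_dual f k s * inverse ((f s)\<^sup>2))"
  by (auto simp: phi_ratio_def phi_ratio_dual_def power_int_minus)

lemma phi_ratio_dual_Suc: "phi_ratio_dual f (Suc k) x
  = of_nat (Suc k) * (LBINT s=0..x. phi_ratio f k s * (f s)\<^sup>2)"
  by (auto simp: phi_ratio_def phi_ratio_dual_def power_int_minus)

lemma phi_ratio_deriv:
  assumes cont: "continuous_on {-r<..<r} f" and nz: "\<And>x. \<bar>x\<bar> < r \<Longrightarrow> f x \<noteq> 0"
    and x: "\<bar>x\<bar> < r"
  shows "(phi_ratio f k has_vector_derivative of_nat k * (phi_ratio_dual f (k - 1) x * inverse ((f x)\<^sup>2))) (at x)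
    \<and> (phi_ratio_dual f k has_vector_derivative of_nat k * (phi_ratio f (k - 1) x * (f x)\<^sup>2)) (at x)"
  using x
proof (induction k arbitrary: x)
  case 0
  show ?case
    by (auto simp: phi_ratio_def[abs_def] phi_ratio_dual_def[abs_def])
next
  case (Suc k)
  have "isCont (phi_ratio f k) y" "isCont (phi_ratio_dual f k) y" if "\<bar>y\<bar> < r" for y
    using Suc.IH[OF that] has_vector_derivative_continuous by blast+
  then have "continuous_on {-r<..<r} (phi_ratio f k)" "continuous_on {-r<..<r} (phi_ratio_dual f k)"
    by (auto intro!: continuous_at_imp_continuous_on)
  then have "continuous_on {-r<..<r} (\<lambda>s. phi_ratio_dual f k s * inverse ((f s)\<^sup>2))"
    "continuous_on {-r<..<r} (\<lambda>s. phi_ratio f k s * (f s)\<^sup>2)"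
    using nz by (auto intro!: continuous_intros cont)
  note * = this[THEN has_vector_derivative_LBINT_0[OF _ Suc.prems]]
  show ?case
    unfolding phi_ratio_Suc[abs_def] phi_ratio_dual_Suc[abs_def]
    using has_vector_derivative_mult_right[OF *(1)] has_vector_derivative_mult_right[OF *(2)]
    by simp
qed

lemma phi_ratio_0: "phi_ratio f k 0 = (if k = 0 then 1 else 0)"
proof (cases k)
  case (Suc i)
  then show ?thesis
    using phi_ratio_Suc[of f i 0] by (simp flip: zero_ereal_def)
qed (simp add: phi_ratio_def)

lemma phi_ratio_dual_0: "phi_ratio_dual f k 0 = (if k = 0 then 1 else 0)"
proof (cases k)
  case (Suc i)
  then show ?thesis
    using phi_ratio_dual_Suc[of f i 0] by (simp flip: zero_ereal_def)
qed (simp add: phi_ratio_dual_def)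

text \<open>Differentiating \<open>\<phi>\<^sub>k = f Y\<^sub>k\<close>, where \<open>Y\<^sub>k' = k W\<^sub>k\<^sub>-\<^sub>1 / f\<^sup>2\<close> and \<open>W\<^sub>k' = k Y\<^sub>k\<^sub>-\<^sub>1 f\<^sup>2\<close>, gives
  \<open>\<phi>\<^sub>k' = f' Y\<^sub>k + k W\<^sub>k\<^sub>-\<^sub>1 / f\<close>. In the second derivative the mixed terms with \<open>f' W\<^sub>k\<^sub>-\<^sub>1 / f\<^sup>2\<close> cancel.\<close>

lemma formal_powers_phi:
  fixes q f f' :: "real \<Rightarrow> complex"
  assumes r: "0 < r"
    and f_deriv: "\<And>x. \<bar>x\<bar> < r \<Longrightarrow> (f has_vector_derivative f' x) (at x)"
    and f_ode: "\<And>x. \<bar>x\<bar> < r \<Longrightarrow> (f' has_vector_derivative q x * f x) (at x)"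
    and nz: "\<And>x. \<bar>x\<bar> < r \<Longrightarrow> f x \<noteq> 0" and f_0: "f 0 = 1"
  shows "formal_powers r q (f' 0) (\<lambda>j x. phi f j x / fact j)
    (\<lambda>j x. (f' x * phi_ratio f j x + of_nat j * (phi_ratio_dual f (j - 1) x * inverse (f x))) / fact j)"
proof
  show "0 < r"
    by (rule r)
  have cont: "continuous_on {-r<..<r} f"
    by (intro continuous_at_imp_continuous_on ballI has_vector_derivative_continuous[OF f_deriv]) auto
  note deriv = phi_ratio_deriv[OF cont nz, THEN conjunct1] phi_ratio_deriv[OF cont nz, THEN conjunct2]
  fix j :: nat
  show "phi f j 0 / fact j = (if j = 0 then 1 else 0)"
    by (simp add: phi_eq_phi_ratio f_0 phi_ratio_0)
  show "(f' 0 * phi_ratio f j 0 + of_nat j * (phi_ratio_dual f (j - 1) 0 * inverse (f 0))) / fact j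
    = (if j = 0 then f' 0 else if j = 1 then 1 else 0)"
    by (simp add: f_0 phi_ratio_0 phi_ratio_dual_0)
  fix x :: real
  assume x: "\<bar>x\<bar> < r"
  have inv: "((\<lambda>x. inverse (f x)) has_vector_derivative - (f' x * inverse ((f x)\<^sup>2))) (at x)"
    using field_vector_diff_chain_at[OF f_deriv[OF x] DERIV_inverse[OF nz[OF x]]]
    by (simp add: o_def power_inverse numeral_2_eq_2)
  have "((\<lambda>x. f x * phi_ratio f j x / fact j) has_vector_derivative
    (f x * (of_nat j * (phi_ratio_dual f (j - 1) x * inverse ((f x)\<^sup>2))) + f' x * phi_ratio f j x) / fact j) (at x)"
    using x by (intro derivative_intros deriv f_deriv) auto
  then show "((\<lambda>x. phi f j x / fact j) has_vector_derivative
    (f' x * phi_ratio f j x + of_nat j * (phi_ratio_dual f (j - 1) x * inverse (f x))) / fact j) (at x)"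
    using nz[OF x] by (simp add: phi_eq_phi_ratio[abs_def] field_simps power2_eq_square)
  have lag: "lag 2 (\<lambda>j x. phi f j x / fact j) j x
    = of_nat j * (of_nat (j - 1) * (f x * phi_ratio f (j - 2) x)) / fact j"
  proof (cases "j < 2")
    case False
    then obtain i where "j = i + 2"
      using le_Suc_ex[of 2 j] by (auto simp: add.commute)
    then show ?thesis
      by (simp add: lag_def phi_eq_phi_ratio field_simps del: of_nat_Suc)
  qed (auto simp: lag_def less_2_cases_iff)
  have "((\<lambda>x. (f' x * phi_ratio f j x + of_nat j * (phi_ratio_dual f (j - 1) x * inverse (f x))) / fact j)
    has_vector_derivative
      (f' x * (of_nat j * (phi_ratio_dual f (j - 1) x * inverse ((f x)\<^sup>2))) + q x * f x * phi_ratio f j x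
       + of_nat j * (phi_ratio_dual f (j - 1) x * - (f' x * inverse ((f x)\<^sup>2))
         + of_nat (j - 1) * (phi_ratio f (j - 1 - 1) x * (f x)\<^sup>2) * inverse (f x))) / fact j) (at x)"
    using x by (intro derivative_intros has_vector_derivative_mult_right deriv f_ode inv) auto
  then show "((\<lambda>x. (f' x * phi_ratio f j x + of_nat j * (phi_ratio_dual f (j - 1) x * inverse (f x))) / fact j)
    has_vector_derivative q x * (phi f j x / fact j)
      + lag 2 (\<lambda>j x. phi f j x / fact j) j x) (at x)"
    unfolding lag
    by (rule has_vector_derivative_eq_rhs)
      (use nz[OF x] in \<open>simp add: phi_eq_phi_ratio numeral_2_eq_2 field_simps\<close>)
qed

lemma wave_c_eq: "wave_c f n x / fact n
  = (\<Sum>k\<le>n. if even k then phi f (n - k) x / fact (n - k) * divpow k x else 0)"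
  unfolding wave_c_def sum_divide_distrib
  by (rule sum.mono_neutral_cong_left) (auto simp: divpow_def binomial_fact mult_ac)

lemma wave_s_eq: "wave_s f n x / fact n
  = (\<Sum>k\<le>n. if odd k then phi f (n - k) x / fact (n - k) * divpow k x else 0)"
  unfolding wave_s_def sum_divide_distrib
  by (rule sum.mono_neutral_cong_left) (auto simp: divpow_def binomial_fact mult_ac)

lemma sum_wave_c: "(\<Sum>n\<le>M. \<alpha> n * (wave_c f n x / fact n))
  = (\<Sum>(j, k) | j + k \<le> M. if even k then \<alpha> (j + k) * (phi f j x / fact j) * divpow k x else 0)"
  unfolding sum_pairs_le_by_total wave_c_eq sum_distrib_left
  by (intro sum.cong refl) auto

lemma sum_wave_s: "(\<Sum>n\<le>M. \<beta> n * (wave_s f n x / fact n))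
  = (\<Sum>(j, k) | j + k \<le> M. if odd k then \<beta> (j + k) * (phi f j x / fact j) * divpow k x else 0)"
  unfolding sum_pairs_le_by_total wave_s_eq sum_distrib_left
  by (intro sum.cong refl) auto

section \<open>Equality of the even coefficients\<close>

text \<open>Adding the two expansions prescribes \<open>K\<close> on \<open>t = x\<close>; subtracting them and reflecting \<open>x\<close>
  prescribes it on the other characteristic, where the contributions of \<open>q\<close> cancel.\<close>

theorem proposition6p9:
  fixes b c :: real and N :: nat and q f f' :: "real \<Rightarrow> complex" and h :: complex
    and \<alpha> \<beta> :: "nat \<Rightarrow> complex"
  assumes q_cont: "continuous_on {-b..b} q"
    and f_deriv: "\<And>x. x \<in> {-b..b} \<Longrightarrow> (f has_vector_derivative f' x) (at x within {-b..b})"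
    and f_ode: "\<And>x. x \<in> {-b..b} \<Longrightarrow> (f' has_vector_derivative q x * f x) (at x within {-b..b})"
    and f_nonzero: "\<And>x. x \<in> {-b..b} \<Longrightarrow> f x \<noteq> 0"
    and f_0: "f 0 = 1"
    and h_def: "h = f' 0"
    and c_pos: "0 < c" and c_le: "c \<le> b"
    and q_smooth: "Cn_on N q {-c..c}"
    and expansion_c:
      "(\<lambda>x::real. h / 2 + 1 / 4 * (LBINT s=0..x. q s)
          - (\<Sum>n=0..N+1. \<alpha> n * (wave_c f n x / fact n)))
        \<in> o[at 0](\<lambda>x. complex_of_real x ^ (N + 1))"
    and expansion_s:
      "(\<lambda>x::real. 1 / 4 * (LBINT s=0..x. q s)
          - (\<Sum>n=1..N+1. \<beta> n * (wave_s f n x / fact n)))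
        \<in> o[at 0](\<lambda>x. complex_of_real x ^ (N + 1))"
  shows "\<forall>n\<in>{1..(N + 1) div 2}. \<alpha> (2 * n) = \<beta> (2 * n)"
proof -
  have b: "0 < b"
    using c_pos c_le by simp
  have at: "at x within {-b..b} = at x" "x \<in> {-b..b}" if "\<bar>x\<bar> < b" for x
    using that by (auto intro!: at_within_interior)
  interpret formal_powers b q h "\<lambda>j x. phi f j x / fact j"
    "\<lambda>j x. (f' x * phi_ratio f j x + of_nat j * (phi_ratio_dual f (j - 1) x * inverse (f x))) / fact j"
    unfolding h_def by (rule formal_powers_phi[OF b]) (use at f_deriv f_ode f_nonzero f_0 in \<open>force+\<close>)
  define Q where "Q x = (LBINT s=0..x. q s)" for x :: real
  define Uc where "Uc x = (\<Sum>(j, k) | j + k \<le> N + 1.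
    if even k then \<alpha> (j + k) * (phi f j x / fact j) * divpow k x else 0)" for x
  define Us where "Us x = (\<Sum>(j, k) | j + k \<le> N + 1.
    if odd k then \<beta> (j + k) * (phi f j x / fact j) * divpow k x else 0)" for x
  have c: "(\<lambda>x. h / 2 + 1 / 4 * Q x - Uc x) \<in> o[at 0](\<lambda>x. of_real x ^ (N + 1))"
    using expansion_c unfolding Uc_def sum_wave_c[symmetric] Q_def atLeast0AtMost .
  have "(\<Sum>n=1..N+1. \<beta> n * (wave_s f n x / fact n)) = (\<Sum>n\<le>N+1. \<beta> n * (wave_s f n x / fact n))" for x
    by (rule sum.mono_neutral_left) (auto simp: wave_s_0 not_le)
  then have s: "(\<lambda>x. 1 / 4 * Q x - Us x) \<in> o[at 0](\<lambda>x. of_real x ^ (N + 1))"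
    using expansion_s unfolding Us_def sum_wave_s[symmetric] Q_def by simp
  have diag: "(\<Sum>(j, k) | j + k \<le> N + 1. interlace \<alpha> \<beta> j k * (phi f j x / fact j) * divpow k x) = Uc x + Us x" for x
    unfolding Uc_def Us_def sum.distrib[symmetric] by (intro sum.cong refl) (auto simp: interlace_def)
  have antidiag: "(\<Sum>(j, k) | j + k \<le> N + 1. interlace \<alpha> \<beta> j k * (phi f j (- x) / fact j) * divpow k x)
      = Uc (- x) - Us (- x)" for x
    unfolding Uc_def Us_def sum_subtractf[symmetric]
    by (intro sum.cong refl) (auto simp: interlace_def divpow_uminus)
  interpret approximate_kernel b q h "\<lambda>j x. phi f j x / fact j"
    "\<lambda>j x. (f' x * phi_ratio f j x + of_nat j * (phi_ratio_dual f (j - 1) x * inverse (f x))) / fact j"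
    "N + 1" \<alpha> \<beta> Q
  proof
    show "(Q has_vector_derivative q x) (at x)" if "\<bar>x\<bar> < b" for x
      unfolding Q_def[abs_def] using that
      by (intro has_vector_derivative_LBINT_0 continuous_on_subset[OF q_cont]) auto
    show "Q 0 = 0"
      by (simp add: Q_def flip: zero_ereal_def)
    have "(\<lambda>x. (-2) * (h / 2 + 1 / 4 * Q x - Uc x + (1 / 4 * Q x - Us x)))
        \<in> o[at 0](\<lambda>x. of_real x ^ (N + 1))"
      using sum_in_smallo(1)[OF c s] by (subst landau_o.small.cmult_in_iff) auto
    then show "(\<lambda>x. 2 * (\<Sum>(j, k) | j + k \<le> N + 1. interlace \<alpha> \<beta> j k * (phi f j x / fact j) * divpow k x) - h - Q x)
      \<in> o[at 0](\<lambda>x. of_real x ^ (N + 1))"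
      unfolding diag by (simp add: algebra_simps)
    have "(\<lambda>x. (-2) * (h / 2 + 1 / 4 * Q (- x) - Uc (- x) - (1 / 4 * Q (- x) - Us (- x))))
        \<in> o[at 0](\<lambda>x. of_real x ^ (N + 1))"
      using flat_reflect[OF sum_in_smallo(2)[OF c s]] by (subst landau_o.small.cmult_in_iff) auto
    then show "(\<lambda>x. 2 * (\<Sum>(j, k) | j + k \<le> N + 1. interlace \<alpha> \<beta> j k * (phi f j (- x) / fact j) * divpow k x) - h)
      \<in> o[at 0](\<lambda>x. of_real x ^ (N + 1))"
      unfolding antidiag by (simp add: algebra_simps)
  qed
  show ?thesis
    by (intro ballI even_coeffs_agree) auto
qed

end
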